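(* Let $(H_i)_{i\ge1},(U_i)_{i\ge1},(V_i)_{i\ge1}$ be sequences of stable scalar systems for which there are constants $\gamma_h,\gamma_u,\gamma_v<\infty$ with $\|H_i\|\le\gamma_h$, $\|U_i\|\le\gamma_u$, $\|V_i\|\le\gamma_v$ for all $i$. Let $(\gamma_i)_{i\ge1}$ be constants with $0<\gamma_i<\infty$ and $\sup_i\gamma_i<\infty$, and let $\alpha=\alpha(n)>0$ satisfy $\alpha(n)=o(\sqrt n)$ as $n\to\infty$. For each $n$ put $$\psi^o_n:=\inf_{Q\in\mathcal Q^{\alpha}_n}\big\|\mathbf T_n\,(H^{(n)}-U^{(n)}QV^{(n)})\big\|,$$ and for each $M$ put $$\mu_M:=\inf_{Z\in\mathcal Q^{\alpha}_M}\big\|H^{(M)}-U^{(M)}ZV^{(M)}\big\|,\qquad \mu^o:=\limsup_{M\to\infty}\mu_M .$$ Let $Z^{o,M}$ be a diagonal solution of the problem defining $\mu_M$. Then $$\lim_{n\to\infty}\psi^o_n=\mu^o,$$ and the decentralized (diagonal) choice $Z^{o,M}$ is arbitrarily close to optimal for sufficiently large $M$: for every $\varepsilon>0$ there is $M_0$ such that for all $M\ge M_0$, $\big\|\mathbf T_M\,(H^{(M)}-U^{(M)}Z^{o,M}V^{(M)})\big\|\le\psi^o_M+\varepsilon$.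
   Context: A stable scalar system is a causal discrete-time LTI SISO system with real impulse response $(M_k)_{k\ge0}$, identified with its transfer function $M(\lambda)=\sum_{k\ge0}M_k\lambda^k$, having finite $\mathcal H_\infty$ norm. For a (matrix-valued) stable transfer function, $\|M\|:=\sup_\omega\sigma_{\max}[M(e^{\jmath\omega})]$ denotes the $\mathcal H_\infty$ norm, with $\sigma_{\max}$ the largest singular value; this equals the $\ell_2$-induced norm. $H^{(n)}=\mathrm{diag}(H_1,\dots,H_n)$, $U^{(n)}=\mathrm{diag}(U_1,\dots,U_n)$, $V^{(n)}=\mathrm{diag}(V_1,\dots,V_n)$. $\mathbf T_n:=I_n-\frac1n\mathbf 1\mathbf 1^\top$, where $\mathbf 1$ is the all-ones vector of length $n$. For $\alpha>0$, an $n\times n$ matrix $Q=[Q_{ij}]$ of stable scalar systems is $\alpha$-column diagonal dominant if $\alpha\|Q_{jj}\|\ge\sum_{i\ne j}\|Q_{ij}\|$ for all $j=1,\dots,n$. $\mathcal Q^\alpha_n$ is the set of all $n\times n$ matrices $Q$ of stable scalar systems which are $\alpha(n)$-column diagonal dominant and satisfy $\|Q_{ii}\|\le\gamma_i$ for $1\le i\le n$. Interpretation: $\Phi=H-UQV$ is the closed-loop map from disturbances $w$ to regulated signals $z$ of $n$ decoupled agents in Youla parametrization ($Q$ is the free parameter), and $\Psi=\mathbf T_n\Phi$ is the map from $w$ to the deviations $z_i-\frac1n\sum_j z_j$. A diagonal $Q$ corresponds to a decentralized controller. Convention: the infimum defining $\mu_M$ is assumed to be attained. *)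

theory Defs
  imports
    "HOL-Analysis.Analysis"
    "HOL-Library.Landau_Symbols"
    "Jordan_Normal_Form.Schur_Decomposition"
begin

text \<open>A causal discrete-time LTI SISO system is given by its real impulse response.
  Families of systems and matrix rows and columns are indexed from 0: the \<open>n\<close>-agent
  problem involves the systems with index \<open>i < n\<close>.\<close>

type_synonym sys = "nat \<Rightarrow> real"

definition transfer_fun :: "sys \<Rightarrow> complex \<Rightarrow> complex" where
  "transfer_fun M z = (\<Sum>k. complex_of_real (M k) * z ^ k)"

text \<open>Finite \<open>H\<^sub>\<infinity>\<close> norm means that the transfer function is a bounded analytic function on
  the open unit disc. Bounded boundary values alone would not be enough: \<open>exp ((1 + z) / (1 - z))\<close>
  has modulus 1 almost everywhere on the circle but is unbounded in the disc.\<close>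

definition stable_sys :: "sys \<Rightarrow> bool" where
  "stable_sys M \<longleftrightarrow>
     (\<forall>z. cmod z < 1 \<longrightarrow> summable (\<lambda>k. complex_of_real (M k) * z ^ k)) \<and>
     bounded (transfer_fun M ` ball 0 1)"

text \<open>The value of the transfer function at \<open>exp (\<i> \<omega>)\<close> is its radial limit, which for a stable
  system exists for almost every \<open>\<omega>\<close> by Fatou's theorem; the power series itself need not converge
  on the circle. Accordingly, suprema over \<open>\<omega>\<close> are essential suprema.\<close>

definition freq_resp :: "sys \<Rightarrow> real \<Rightarrow> complex" where
  "freq_resp M \<omega> = Lim (at_left 1) (\<lambda>r. transfer_fun M (complex_of_real r * cis \<omega>))"

definition ess_sup :: "(real \<Rightarrow> real) \<Rightarrow> real" where
  "ess_sup g = Inf {c. AE \<omega> in lborel. g \<omega> \<le> c}"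

definition singular_values :: "complex mat \<Rightarrow> real set" where
  "singular_values A = {s. 0 \<le> s \<and> eigenvalue (mat_adjoint A * A) (complex_of_real (s\<^sup>2))}"

definition sigma_max :: "complex mat \<Rightarrow> real" where
  "sigma_max A = Max (singular_values A)"

text \<open>The norm of a matrix-valued stable transfer function, given by its values on the unit
  circle, and of a scalar system, whose only singular value is the modulus.\<close>

definition hinf_norm :: "(real \<Rightarrow> complex mat) \<Rightarrow> real" where
  "hinf_norm G = ess_sup (\<lambda>\<omega>. sigma_max (G \<omega>))"

definition sys_norm :: "sys \<Rightarrow> real" where
  "sys_norm M = ess_sup (\<lambda>\<omega>. cmod (freq_resp M \<omega>))"

definition column_dominant :: "real \<Rightarrow> nat \<Rightarrow> sys mat \<Rightarrow> bool" where
  "column_dominant a n Q \<longleftrightarrow>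
     (\<forall>j<n. a * sys_norm (Q $$ (j, j)) \<ge> (\<Sum>i\<in>{..<n} - {j}. sys_norm (Q $$ (i, j))))"

definition Qset :: "(nat \<Rightarrow> real) \<Rightarrow> (nat \<Rightarrow> real) \<Rightarrow> nat \<Rightarrow> sys mat set" where
  "Qset \<alpha> \<gamma> n = {Q \<in> carrier_mat n n.
     (\<forall>i<n. \<forall>j<n. stable_sys (Q $$ (i, j))) \<and>
     column_dominant (\<alpha> n) n Q \<and>
     (\<forall>i<n. sys_norm (Q $$ (i, i)) \<le> \<gamma> i)}"

definition diagonal_sys :: "sys mat \<Rightarrow> bool" where
  "diagonal_sys Q \<longleftrightarrow>
     (\<forall>i<dim_row Q. \<forall>j<dim_col Q. i \<noteq> j \<longrightarrow> Q $$ (i, j) = (\<lambda>k. 0))"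

definition Tmat :: "nat \<Rightarrow> complex mat" where
  "Tmat n = 1\<^sub>m n - (1 / of_nat n) \<cdot>\<^sub>m Matrix.mat n n (\<lambda>(i, j). 1)"

definition diag_resp :: "nat \<Rightarrow> (nat \<Rightarrow> sys) \<Rightarrow> real \<Rightarrow> complex mat" where
  "diag_resp n S \<omega> = mat_diag n (\<lambda>i. freq_resp (S i) \<omega>)"

definition Phi ::
  "(nat \<Rightarrow> sys) \<Rightarrow> (nat \<Rightarrow> sys) \<Rightarrow> (nat \<Rightarrow> sys) \<Rightarrow> nat \<Rightarrow> sys mat \<Rightarrow> real \<Rightarrow> complex mat" where
  "Phi H U V n Q \<omega> =
     diag_resp n H \<omega> - diag_resp n U \<omega> * map_mat (\<lambda>M. freq_resp M \<omega>) Q * diag_resp n V \<omega>"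

definition Psi ::
  "(nat \<Rightarrow> sys) \<Rightarrow> (nat \<Rightarrow> sys) \<Rightarrow> (nat \<Rightarrow> sys) \<Rightarrow> nat \<Rightarrow> sys mat \<Rightarrow> real \<Rightarrow> complex mat" where
  "Psi H U V n Q \<omega> = Tmat n * Phi H U V n Q \<omega>"

definition psi_opt ::
  "(nat \<Rightarrow> sys) \<Rightarrow> (nat \<Rightarrow> sys) \<Rightarrow> (nat \<Rightarrow> sys) \<Rightarrow> (nat \<Rightarrow> real) \<Rightarrow> (nat \<Rightarrow> real) \<Rightarrow> nat \<Rightarrow> real" where
  "psi_opt H U V \<alpha> \<gamma> n = (INF Q\<in>Qset \<alpha> \<gamma> n. hinf_norm (Psi H U V n Q))"

definition mu_opt ::
  "(nat \<Rightarrow> sys) \<Rightarrow> (nat \<Rightarrow> sys) \<Rightarrow> (nat \<Rightarrow> sys) \<Rightarrow> (nat \<Rightarrow> real) \<Rightarrow> (nat \<Rightarrow> real) \<Rightarrow> nat \<Rightarrow> real" where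
  "mu_opt H U V \<alpha> \<gamma> n = (INF Q\<in>Qset \<alpha> \<gamma> n. hinf_norm (Phi H U V n Q))"

definition mu_solution ::
  "(nat \<Rightarrow> sys) \<Rightarrow> (nat \<Rightarrow> sys) \<Rightarrow> (nat \<Rightarrow> sys) \<Rightarrow> (nat \<Rightarrow> real) \<Rightarrow> (nat \<Rightarrow> real) \<Rightarrow> nat \<Rightarrow> sys mat \<Rightarrow> bool"
  where
  "mu_solution H U V \<alpha> \<gamma> n Z \<longleftrightarrow>
     Z \<in> Qset \<alpha> \<gamma> n \<and> hinf_norm (Phi H U V n Z) = mu_opt H U V \<alpha> \<gamma> n"

end

theory Submission
  imports Defs "Jordan_Normal_Form.Spectral_Radius" "HOL-Real_Asymp.Real_Asymp"
begin

text \<open>Put \<open>D = diag Q\<close> for a feasible \<open>Q\<close>. The \<open>i\<close>-th diagonal entry of \<open>\<Psi> = T \<Phi>\<close> is \<open>\<Phi>\<^sub>i\<^sub>i\<close> minus the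
  average of column \<open>i\<close> of \<open>\<Phi>\<close>, and column dominance bounds this average by \<open>O((1 + \<alpha>(n)) / n)\<close>.
  The closed loop of \<open>D\<close> is diagonal with entries \<open>\<Phi>\<^sub>i\<^sub>i\<close>, so \<open>\<mu>\<^sub>n \<le> \<psi>\<^sub>n + o(1)\<close>; conversely
  \<open>\<psi>\<^sub>n \<le> \<mu>\<^sub>n\<close> because \<open>T\<close> is a contraction. Since diagonal \<open>Q\<close> suffice for \<open>\<mu>\<^sub>n\<close> and can be truncated,
  \<open>\<mu>\<^sub>n\<close> is increasing, hence convergent.\<close>

section \<open>Singular values\<close>

definition vnorm2 :: "complex vec \<Rightarrow> real" where
  "vnorm2 v = (\<Sum>i<dim_vec v. (cmod (vec_index v i))\<^sup>2)"

text \<open>The real part of the Hermitian inner product. Only this part enters the expansion of the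
  squared norm of \<open>x - t y\<close> with real \<open>t\<close>, so all comparisons below stay
  in the reals.\<close>

definition rinner :: "complex vec \<Rightarrow> complex vec \<Rightarrow> real" where
  "rinner v w = (\<Sum>i<dim_vec v. Re (vec_index v i * cnj (vec_index w i)))"

lemma vnorm2_nonneg: "0 \<le> vnorm2 v"
  by (simp add: vnorm2_def sum_nonneg)

lemma rinner_self: "rinner v v = vnorm2 v"
  unfolding vnorm2_def rinner_def by (rule sum.cong) (simp_all add: cmod_power2, simp add: power2_eq_square)

lemma vnorm2_eq_0_iff:
  assumes "v \<in> carrier_vec n"
  shows "vnorm2 v = 0 \<longleftrightarrow> v = 0\<^sub>v n"
proof
  assume "vnorm2 v = 0"
  then have "\<forall>i<n. cmod (vec_index v i) = 0"
    using assms by (simp add: vnorm2_def sum_nonneg_eq_0_iff)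
  then show "v = 0\<^sub>v n" using assms by (intro eq_vecI) auto
qed (simp add: vnorm2_def)

lemma rinner_minus_left:
  assumes "x \<in> carrier_vec n" "y \<in> carrier_vec n"
  shows "rinner (x - y) z = rinner x z - rinner y z"
  using assms
  by (auto simp: rinner_def sum_subtractf[symmetric] left_diff_distrib simp del: times_complex.sel
      intro!: sum.cong)

lemma rinner_smult_left:
  "rinner (complex_of_real t \<cdot>\<^sub>v x) z = t * rinner x z"
  by (auto simp: rinner_def sum_distrib_left algebra_simps intro!: sum.cong)

lemma vnorm2_minus_smult:
  assumes x: "x \<in> carrier_vec n" and y: "y \<in> carrier_vec n"
  shows "vnorm2 (x - complex_of_real t \<cdot>\<^sub>v y) = vnorm2 x - 2 * t * rinner x y + t\<^sup>2 * vnorm2 y"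
proof -
  have "(cmod (a - complex_of_real t * b))\<^sup>2
      = (cmod a)\<^sup>2 - 2 * t * Re (a * cnj b) + t\<^sup>2 * (cmod b)\<^sup>2" for a b
    unfolding cmod_power2 by (simp add: power2_eq_square algebra_simps)
  then show ?thesis using assms
    by (simp add: vnorm2_def rinner_def sum_subtractf sum.distrib sum_distrib_left
        del: times_complex.sel)
qed

lemma index_mult_mat_vec_sum:
  assumes "A \<in> carrier_mat nr nc" "v \<in> carrier_vec nc" "i < nr"
  shows "vec_index (A *\<^sub>v v) i = (\<Sum>j<nc. A $$ (i, j) * vec_index v j)"
  using assms by (auto simp: scalar_prod_def atLeast0LessThan intro!: sum.cong)

lemma mat_adjoint_carrier:
  assumes "A \<in> carrier_mat nr nc"
  shows "mat_adjoint A \<in> carrier_mat nc nr"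
  using assms mat_of_rows_carrier(1)[of nr "map conjugate (cols A)"] by (simp add: mat_adjoint_def)

lemma index_mat_adjoint:
  assumes "(A :: complex mat) \<in> carrier_mat nr nc" "i < nc" "j < nr"
  shows "mat_adjoint A $$ (i, j) = cnj (A $$ (j, i))"
  using assms unfolding mat_adjoint_def
  by (simp add: mat_of_rows_def)

text \<open>Both sides are the real part of one double sum over the entries, summed in different
  orders.\<close>

lemma rinner_mult_mat_adjoint:
  assumes A: "A \<in> carrier_mat n n" and x: "x \<in> carrier_vec n" and y: "y \<in> carrier_vec n"
  shows "rinner (mat_adjoint A *\<^sub>v x) y = rinner x (A *\<^sub>v y)"
proof -
  have A': "mat_adjoint A \<in> carrier_mat n n" by (rule mat_adjoint_carrier[OF A])
  have "rinner (mat_adjoint A *\<^sub>v x) y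
      = Re (\<Sum>i<n. \<Sum>j<n. cnj (A $$ (j, i)) * vec_index x j * cnj (vec_index y i))"
    unfolding rinner_def using A A' x y
    by (simp add: index_mult_mat_vec_sum[OF A' x] index_mat_adjoint[OF A] sum_distrib_right
        del: index_mult_mat_vec)
  also have "\<dots> = Re (\<Sum>j<n. \<Sum>i<n. cnj (A $$ (j, i)) * vec_index x j * cnj (vec_index y i))"
    by (subst sum.swap) simp
  also have "\<dots> = rinner x (A *\<^sub>v y)"
    unfolding rinner_def using A x y
    by (simp add: index_mult_mat_vec_sum[OF A y] sum_distrib_left mult_ac
        del: index_mult_mat_vec)
  finally show ?thesis .
qed

text \<open>Cauchy-Schwarz is applied to each row, and the \<open>n\<close> equal row bounds are
  added. The constant is crude, but it serves only to show that gains are finite.\<close>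

lemma vnorm2_mult_mat_le_entries:
  assumes A: "A \<in> carrier_mat n n"
    and C: "\<And>i j. i < n \<Longrightarrow> j < n \<Longrightarrow> cmod (A $$ (i, j)) \<le> C"
    and v: "v \<in> carrier_vec n"
  shows "vnorm2 (A *\<^sub>v v) \<le> (real n * C)\<^sup>2 * vnorm2 v"
proof (cases "n = 0")
  case True
  then show ?thesis using A v by (simp add: vnorm2_def)
next
  case False
  then have C0: "C \<ge> 0" using C[of 0 0] norm_ge_zero order_trans by blast
  have "(cmod (vec_index (A *\<^sub>v v) i))\<^sup>2 \<le> real n * C\<^sup>2 * vnorm2 v" if i: "i < n" for i
  proof -
    have "cmod (vec_index (A *\<^sub>v v) i) \<le> (\<Sum>j<n. C * cmod (vec_index v j))"
      unfolding index_mult_mat_vec_sum[OF A v i]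
      by (intro sum_norm_le) (auto simp: norm_mult intro!: mult_right_mono C i)
    then have "(cmod (vec_index (A *\<^sub>v v) i))\<^sup>2 \<le> (\<Sum>j<n. C * cmod (vec_index v j))\<^sup>2"
      by (intro power_mono) auto
    also have "\<dots> \<le> (\<Sum>j<n. C\<^sup>2) * (\<Sum>j<n. (cmod (vec_index v j))\<^sup>2)"
      by (rule Cauchy_Schwarz_ineq_sum)
    finally show ?thesis using v by (simp add: vnorm2_def)
  qed
  then have "vnorm2 (A *\<^sub>v v) \<le> (\<Sum>i<n. real n * C\<^sup>2 * vnorm2 v)"
    unfolding vnorm2_def[of "A *\<^sub>v v"] using A
    by (simp only: dim_mult_mat_vec carrier_matD) (intro sum_mono, simp)
  also have "\<dots> = (real n * C)\<^sup>2 * vnorm2 v" by (simp add: power2_eq_square)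
  finally show ?thesis .
qed

lemma vnorm2_mult_mat_bounded:
  assumes A: "A \<in> carrier_mat n n"
  obtains K where "0 < K" "\<And>v. v \<in> carrier_vec n \<Longrightarrow> vnorm2 (A *\<^sub>v v) \<le> K * vnorm2 v"
proof -
  let ?C = "\<Sum>(i,j)\<in>{..<n}\<times>{..<n}. cmod (A $$ (i, j))"
  have "cmod (A $$ (i, j)) \<le> ?C" if "i < n" "j < n" for i j
    using member_le_sum[of "(i,j)" "{..<n}\<times>{..<n}" "\<lambda>(i,j). cmod (A $$ (i, j))"] that by auto
  from vnorm2_mult_mat_le_entries[OF A this]
  \<comment> \<open>The added 1 makes the constant strictly positive, because it occurs later as a
    divisor.\<close>
  have "vnorm2 (A *\<^sub>v v) \<le> ((real n * ?C)\<^sup>2 + 1) * vnorm2 v" if "v \<in> carrier_vec n" for v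
    using that vnorm2_nonneg[of v] by (smt (verit) mult_right_mono)
  moreover have "0 < (real n * ?C)\<^sup>2 + 1" by (smt (verit) zero_le_power2)
  ultimately show ?thesis using that by blast
qed

text \<open>The positive semidefinite form \<open>q v = m \<bar>v\<bar>\<^sup>2 - \<bar>A v\<bar>\<^sup>2\<close> belongs to \<open>m I - A\<^sup>* A\<close>, so
  \<open>q (v - t w) \<ge> 0\<close> with \<open>w = (m I - A\<^sup>* A) v\<close> gives \<open>\<bar>w\<bar>\<^sup>2 \<le> (m + 1) q v\<close>
  at \<open>t = 1 / (m + 1)\<close> (the proof uses \<open>- w\<close> and \<open>- t\<close>). If \<open>m\<close> is no eigenvalue,
  \<open>\<bar>v\<bar>\<close> is controlled by \<open>\<bar>w\<bar>\<close>. Hence the least bound is an eigenvalue and no compactness is needed.\<close>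

lemma not_eigenvalue_improve_bound:
  fixes A :: "complex mat"
  assumes A: "A \<in> carrier_mat n n" and m0: "0 \<le> m"
    and le: "\<And>v. v \<in> carrier_vec n \<Longrightarrow> vnorm2 (A *\<^sub>v v) \<le> m * vnorm2 v"
    and not_eig: "\<not> eigenvalue (mat_adjoint A * A) (complex_of_real m)"
  obtains m' where "m' < m" "\<And>v. v \<in> carrier_vec n \<Longrightarrow> vnorm2 (A *\<^sub>v v) \<le> m' * vnorm2 v"
proof -
  define B where "B = mat_adjoint A * A"
  define C where "C = char_matrix B (complex_of_real m)"
  have A': "mat_adjoint A \<in> carrier_mat n n" by (rule mat_adjoint_carrier[OF A])
  have B: "B \<in> carrier_mat n n" using A A' by (simp add: B_def)
  have C: "C \<in> carrier_mat n n" unfolding C_def by (rule char_matrix_closed[OF B])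
  have "Determinant.det C \<noteq> 0" using not_eig eigenvalue_det[OF B] by (simp add: C_def B_def)
  \<comment> \<open>\<open>D\<close> inverts \<open>B - m I\<close>; its gain \<open>K\<close> is
    what controls \<open>v\<close> by \<open>w\<close>.\<close>
  from det_non_zero_imp_unit[OF C this, of "()"] obtain D
    where D: "D \<in> carrier_mat n n" and DC: "D * C = 1\<^sub>m n"
    unfolding Units_def by (auto simp: ring_mat_simps)
  obtain K where K: "0 < K" "\<And>v. v \<in> carrier_vec n \<Longrightarrow> vnorm2 (D *\<^sub>v v) \<le> K * vnorm2 v"
    using vnorm2_mult_mat_bounded[OF D] by blast
  \<comment> \<open>The improvement combines two estimates: \<open>vnorm2 w / (m + 1)\<close> is at
    most \<open>m * vnorm2 v - vnorm2 (A v)\<close>, and \<open>vnorm2 v\<close> is at most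
    \<open>K * vnorm2 w\<close>.\<close>
  have main: "vnorm2 (A *\<^sub>v v) \<le> (m - 1 / (K * (m + 1))) * vnorm2 v" if v: "v \<in> carrier_vec n" for v
  proof -
    define w where "w = C *\<^sub>v v"
    define t where "t = - 1 / (m + 1)"
    have w: "w \<in> carrier_vec n" using C v by (simp add: w_def)
    have Av: "A *\<^sub>v v \<in> carrier_vec n" and Aw: "A *\<^sub>v w \<in> carrier_vec n" using A v w by auto
    have Cv: "w = mat_adjoint A *\<^sub>v (A *\<^sub>v v) - complex_of_real m \<cdot>\<^sub>v v"
      unfolding w_def C_def char_matrix_def B_def using A A' v
      by (intro eq_vecI) (auto simp: add_mult_distrib_mat_vec[of _ n n])
    \<comment> \<open>This identifies the first-order coefficient of the expansion in
      \<open>t\<close>: \<open>w\<close> is paired with itself, one copy is written out, and the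
      adjoint is moved to the other side.\<close>
    have ww: "rinner (A *\<^sub>v v) (A *\<^sub>v w) - m * rinner v w = vnorm2 w"
    proof -
      have "vnorm2 w = rinner (mat_adjoint A *\<^sub>v (A *\<^sub>v v) - complex_of_real m \<cdot>\<^sub>v v) w"
        using Cv by (simp add: rinner_self)
      also have "\<dots> = rinner (mat_adjoint A *\<^sub>v (A *\<^sub>v v)) w - rinner (complex_of_real m \<cdot>\<^sub>v v) w"
        using A' Av v by (intro rinner_minus_left) auto
      finally show ?thesis
        by (simp add: rinner_smult_left rinner_mult_mat_adjoint[OF A Av w])
    qed
    have eq: "A *\<^sub>v (v - complex_of_real t \<cdot>\<^sub>v w) = A *\<^sub>v v - complex_of_real t \<cdot>\<^sub>v (A *\<^sub>v w)"
      using A v w by (simp add: mult_minus_distrib_mat_vec[OF A] mult_mat_vec[OF A])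
    have "vnorm2 (A *\<^sub>v v) - 2 * t * rinner (A *\<^sub>v v) (A *\<^sub>v w) + t\<^sup>2 * vnorm2 (A *\<^sub>v w)
        \<le> m * (vnorm2 v - 2 * t * rinner v w + t\<^sup>2 * vnorm2 w)"
      using le[of "v - complex_of_real t \<cdot>\<^sub>v w"] v w
      unfolding eq vnorm2_minus_smult[OF Av Aw] vnorm2_minus_smult[OF v w] by simp
    then have q: "0 \<le> (m * vnorm2 v - vnorm2 (A *\<^sub>v v)) + 2 * t * vnorm2 w + t\<^sup>2 * (m * vnorm2 w)"
      unfolding ww[symmetric] using mult_nonneg_nonneg[OF zero_le_power2[of t] vnorm2_nonneg[of "A *\<^sub>v w"]]
      by (simp add: algebra_simps)
    \<comment> \<open>This is m \<le> m + 1 divided by (m + 1)^2. The quadratic term thus uses up at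
      most half of the linear one, and \<open>- t * vnorm2 w\<close> survives.\<close>
    have "t\<^sup>2 * m \<le> - t"
      using m0 by (simp add: t_def power2_eq_square divide_simps)
    then have "t\<^sup>2 * (m * vnorm2 w) \<le> - t * vnorm2 w"
      using mult_right_mono[OF _ vnorm2_nonneg[of w], of "t\<^sup>2 * m" "- t"] by (simp add: mult.assoc)
    with q have q2: "- t * vnorm2 w \<le> m * vnorm2 v - vnorm2 (A *\<^sub>v v)"
      by (simp add: algebra_simps)
    have "v = D *\<^sub>v w"
      unfolding w_def using assoc_mult_mat_vec[OF D C v] DC v by simp
    then have "vnorm2 v \<le> K * vnorm2 w" using K(2)[OF w] by simp
    then have "vnorm2 v / (K * (m + 1)) \<le> - t * vnorm2 w"
    proof -
      have "vnorm2 v / (K * (m + 1)) \<le> K * vnorm2 w / (K * (m + 1))"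
        using \<open>vnorm2 v \<le> K * vnorm2 w\<close> K(1) m0 by (intro divide_right_mono) auto
      then show ?thesis using K(1) by (simp add: t_def)
    qed
    with q2 show ?thesis by (simp add: algebra_simps)
  qed
  show ?thesis
    by (rule that[OF _ main]) (use K(1) m0 in auto)
qed

text \<open>Pairing the eigenvector equation with \<open>v\<close> turns the left side into the
  squared norm of \<open>A v\<close>. Every squared singular value is therefore a gain realized by
  some nonzero vector.\<close>

lemma mult_mat_adjoint_eigenvector:
  fixes A :: "complex mat"
  assumes A: "A \<in> carrier_mat n n" and ev: "eigenvector (mat_adjoint A * A) v (complex_of_real k)"
  shows "v \<in> carrier_vec n" "0 < vnorm2 v" "vnorm2 (A *\<^sub>v v) = k * vnorm2 v"
proof -
  have A': "mat_adjoint A \<in> carrier_mat n n" by (rule mat_adjoint_carrier[OF A])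
  show v: "v \<in> carrier_vec n" using ev A A' by (simp add: eigenvector_def)
  show "0 < vnorm2 v"
    using ev A A' vnorm2_eq_0_iff[OF v] vnorm2_nonneg[of v] by (simp add: eigenvector_def)
  have "mat_adjoint A *\<^sub>v (A *\<^sub>v v) = complex_of_real k \<cdot>\<^sub>v v"
    using ev A A' v by (simp add: eigenvector_def assoc_mult_mat_vec)
  then have "rinner (complex_of_real k \<cdot>\<^sub>v v) v = rinner (A *\<^sub>v v) (A *\<^sub>v v)"
    using rinner_mult_mat_adjoint[OF A, of "A *\<^sub>v v" v] A v by simp
  then show "vnorm2 (A *\<^sub>v v) = k * vnorm2 v" by (simp add: rinner_smult_left rinner_self)
qed

text \<open>Connects the eigenvalue definition with gains: the supremum \<open>m\<close> of the
  squared gains is itself an eigenvalue, and no eigenvalue exceeds it because each one is realized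
  as a squared gain. From here on only these three properties of \<open>sigma_max\<close> are
  used.\<close>

lemma sigma_max_operator_norm:
  assumes A: "A \<in> carrier_mat n n" and n: "1 \<le> n"
  shows "0 \<le> sigma_max A"
    and "\<And>v. v \<in> carrier_vec n \<Longrightarrow> vnorm2 (A *\<^sub>v v) \<le> (sigma_max A)\<^sup>2 * vnorm2 v"
    and "\<exists>v \<in> carrier_vec n. 0 < vnorm2 v \<and> vnorm2 (A *\<^sub>v v) = (sigma_max A)\<^sup>2 * vnorm2 v"
proof -
  define B where "B = mat_adjoint A * A"
  define S where "S = {vnorm2 (A *\<^sub>v v) / vnorm2 v | v. v \<in> carrier_vec n \<and> 0 < vnorm2 v}"
  define m where "m = Sup S"
  have A': "mat_adjoint A \<in> carrier_mat n n" by (rule mat_adjoint_carrier[OF A])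
  have B: "B \<in> carrier_mat n n" using A A' by (simp add: B_def)
  have e: "unit_vec n 0 \<in> carrier_vec n" "unit_vec n 0 \<noteq> (0\<^sub>v n :: complex vec)"
    using n by (auto simp: vec_eq_iff intro!: exI[of _ 0])
  have pos: "0 < vnorm2 v" if "v \<in> carrier_vec n" "v \<noteq> 0\<^sub>v n" for v
    using vnorm2_eq_0_iff[OF that(1)] vnorm2_nonneg[of v] that(2) by linarith
  have "S \<noteq> {}" using pos[OF e] e(1) unfolding S_def by blast
  obtain K where K: "0 < K" "\<And>v. v \<in> carrier_vec n \<Longrightarrow> vnorm2 (A *\<^sub>v v) \<le> K * vnorm2 v"
    using vnorm2_mult_mat_bounded[OF A] by blast
  have S_le: "(\<forall>s\<in>S. s \<le> c) \<longleftrightarrow> (\<forall>v\<in>carrier_vec n. vnorm2 (A *\<^sub>v v) \<le> c * vnorm2 v)" for c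
  proof -
    have "vnorm2 (A *\<^sub>v v) \<le> c * vnorm2 v"
      if "\<forall>s\<in>S. s \<le> c" "v \<in> carrier_vec n" for v
    proof (cases "v = 0\<^sub>v n")
      case True
      then have "vnorm2 v = 0" by (simp add: vnorm2_def)
      then show ?thesis using K(2)[OF that(2)] by simp
    next
      case False
      from pos[OF that(2) False] have "vnorm2 (A *\<^sub>v v) / vnorm2 v \<le> c"
        using that unfolding S_def by auto
      then show ?thesis using pos[OF that(2) False] by (simp add: field_simps)
    qed
    then show ?thesis unfolding S_def by (auto simp: field_simps)
  qed
  have bdd: "bdd_above S" using S_le[of K] K(2) by (meson bdd_above.I)
  have m_le: "vnorm2 (A *\<^sub>v v) \<le> m * vnorm2 v" if "v \<in> carrier_vec n" for v
    using S_le[of m] cSup_upper[OF _ bdd] that by (auto simp: m_def)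
  have m0: "0 \<le> m"
  proof -
    obtain s where s: "s \<in> S" using \<open>S \<noteq> {}\<close> by blast
    then have "0 \<le> s" using vnorm2_nonneg unfolding S_def by auto
    then show ?thesis using cSup_upper[OF s bdd] by (simp add: m_def)
  qed
  \<comment> \<open>Otherwise the least bound could be lowered to some \<open>m' < m\<close> that
    still dominates every quotient in \<open>S\<close>.\<close>
  have eig: "eigenvalue B (complex_of_real m)"
  proof (rule ccontr)
    assume "\<not> eigenvalue B (complex_of_real m)"
    then obtain m' where "m' < m"
      and "\<And>v. v \<in> carrier_vec n \<Longrightarrow> vnorm2 (A *\<^sub>v v) \<le> m' * vnorm2 v"
      using not_eigenvalue_improve_bound[OF A m0 m_le] unfolding B_def by metis
    moreover from this have "m \<le> m'"
      using S_le[of m'] \<open>S \<noteq> {}\<close> unfolding m_def by (intro cSup_least) auto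
    ultimately show False by simp
  qed
  have sv: "sqrt m \<in> singular_values A"
    using eig m0 by (simp add: singular_values_def B_def del: of_real_power)
  have sv_le: "s \<le> sqrt m" if s: "s \<in> singular_values A" for s
  proof -
    obtain v where "eigenvector B v (complex_of_real (s\<^sup>2))" and s0: "0 \<le> s"
      using s by (auto simp: singular_values_def B_def eigenvalue_def)
    note v = mult_mat_adjoint_eigenvector[OF A this(1)[unfolded B_def]]
    have "s\<^sup>2 * vnorm2 v \<le> m * vnorm2 v" using m_le[OF v(1)] v(3) by simp
    then have "s\<^sup>2 \<le> m" using v(2) by simp
    then show ?thesis by (rule real_le_rsqrt)
  qed
  \<comment> \<open>\<open>Max\<close> has its intended meaning only on a finite set. A singular
    value is recovered from its eigenvalue as a square root, so finiteness is inherited from the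
    spectrum.\<close>
  have "finite (singular_values A)"
  proof (rule finite_subset)
    show "singular_values A \<subseteq> (\<lambda>z. sqrt (Re z)) ` {k. eigenvalue B k}"
    proof
      fix s assume "s \<in> singular_values A"
      then have "s = sqrt (Re (complex_of_real (s\<^sup>2)))" "eigenvalue B (complex_of_real (s\<^sup>2))"
        by (auto simp: singular_values_def B_def simp del: of_real_power)
      then show "s \<in> (\<lambda>z. sqrt (Re z)) ` {k. eigenvalue B k}" by blast
    qed
    show "finite ((\<lambda>z. sqrt (Re z)) ` {k. eigenvalue B k})"
      using card_finite_spectrum(1)[OF B] by (simp add: spectrum_def)
  qed
  then have "sigma_max A = sqrt m"
    unfolding sigma_max_def using sv sv_le by (intro Max_eqI) auto
  then have sq: "(sigma_max A)\<^sup>2 = m" "0 \<le> sigma_max A" using m0 by auto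
  show "0 \<le> sigma_max A" by (rule sq(2))
  show "vnorm2 (A *\<^sub>v v) \<le> (sigma_max A)\<^sup>2 * vnorm2 v" if "v \<in> carrier_vec n" for v
    using m_le[OF that] by (simp add: sq)
  obtain v where "eigenvector B v (complex_of_real m)" using eig by (auto simp: eigenvalue_def)
  from mult_mat_adjoint_eigenvector[OF A this[unfolded B_def]]
  show "\<exists>v \<in> carrier_vec n. 0 < vnorm2 v \<and> vnorm2 (A *\<^sub>v v) = (sigma_max A)\<^sup>2 * vnorm2 v"
    by (auto simp: sq)
qed

lemma sigma_max_leI:
  assumes A: "A \<in> carrier_mat n n" and n: "1 \<le> n" and c: "0 \<le> c"
    and le: "\<And>v. v \<in> carrier_vec n \<Longrightarrow> vnorm2 (A *\<^sub>v v) \<le> c\<^sup>2 * vnorm2 v"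
  shows "sigma_max A \<le> c"
proof -
  obtain v where v: "v \<in> carrier_vec n" "0 < vnorm2 v"
    "vnorm2 (A *\<^sub>v v) = (sigma_max A)\<^sup>2 * vnorm2 v"
    using sigma_max_operator_norm(3)[OF A n] by blast
  then have "(sigma_max A)\<^sup>2 \<le> c\<^sup>2" using le[OF v(1)] by simp
  then show ?thesis using c by (rule power2_le_imp_le)
qed

text \<open>The entry is one coordinate of the image of a unit vector. This is how the diagonal
  entries of a closed loop are read off from its norm.\<close>

lemma cmod_index_le_sigma_max:
  assumes A: "A \<in> carrier_mat n n" and i: "i < n" and j: "j < n"
  shows "cmod (A $$ (i, j)) \<le> sigma_max A"
proof -
  have n: "1 \<le> n" using i by simp
  have "vnorm2 (unit_vec n j) = (\<Sum>i<n. if i = j then 1 else 0)"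
    unfolding vnorm2_def by (intro sum.cong) (use j in \<open>auto simp: unit_vec_def\<close>)
  then have e: "vnorm2 (unit_vec n j) = 1" using j by simp
  have "(cmod (A $$ (i, j)))\<^sup>2 = (cmod (vec_index (A *\<^sub>v unit_vec n j) i))\<^sup>2"
    using A i j by simp
  also have "\<dots> \<le> vnorm2 (A *\<^sub>v unit_vec n j)"
    unfolding vnorm2_def using A i by (intro member_le_sum) auto
  also have "\<dots> \<le> (sigma_max A)\<^sup>2"
    using sigma_max_operator_norm(2)[OF A n, of "unit_vec n j"] e by simp
  finally show ?thesis using sigma_max_operator_norm(1)[OF A n] by (rule power2_le_imp_le)
qed

lemma sigma_max_le_entries:
  assumes A: "A \<in> carrier_mat n n" and n: "1 \<le> n"
    and C: "\<And>i j. i < n \<Longrightarrow> j < n \<Longrightarrow> cmod (A $$ (i, j)) \<le> C"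
  shows "sigma_max A \<le> real n * C"
proof (rule sigma_max_leI[OF A n])
  show "0 \<le> real n * C" using order_trans[OF norm_ge_zero C[of 0 0]] n by simp
  show "vnorm2 (A *\<^sub>v v) \<le> (real n * C)\<^sup>2 * vnorm2 v" if "v \<in> carrier_vec n" for v
    by (rule vnorm2_mult_mat_le_entries[OF A C that])
qed

lemma sigma_max_mat_diag_le:
  assumes n: "1 \<le> n" and c: "\<And>i. i < n \<Longrightarrow> cmod (d i) \<le> c"
  shows "sigma_max (mat_diag n d) \<le> c"
proof (rule sigma_max_leI[OF mat_diag_dim n])
  show c0: "0 \<le> c" using c[of 0] n norm_ge_zero[of "d 0"] by linarith
  fix v :: "complex vec" assume v: "v \<in> carrier_vec n"
  have idx: "vec_index (mat_diag n d *\<^sub>v v) i = d i * vec_index v i" if "i < n" for i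
    unfolding index_mult_mat_vec_sum[OF mat_diag_dim v that] using that
    by (simp add: mat_diag_def if_distrib[of "\<lambda>x. x * _"] cong: if_cong)
  have "vnorm2 (mat_diag n d *\<^sub>v v) = (\<Sum>i<n. (cmod (d i))\<^sup>2 * (cmod (vec_index v i))\<^sup>2)"
    unfolding vnorm2_def dim_mult_mat_vec carrier_matD(1)[OF mat_diag_dim]
    by (intro sum.cong) (simp_all add: idx norm_mult power_mult_distrib del: index_mult_mat_vec)
  also have "\<dots> \<le> (\<Sum>i<n. c\<^sup>2 * (cmod (vec_index v i))\<^sup>2)"
    by (intro sum_mono mult_right_mono power_mono c) auto
  also have "\<dots> = c\<^sup>2 * vnorm2 v" using v by (simp add: vnorm2_def sum_distrib_left)
  finally show "vnorm2 (mat_diag n d *\<^sub>v v) \<le> c\<^sup>2 * vnorm2 v" .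
qed

section \<open>The averaging projection\<close>

lemma Tmat_carrier: "Tmat n \<in> carrier_mat n n"
  unfolding Tmat_def by (rule minus_carrier_mat) simp

lemma index_Tmat_sum:
  assumes "i < n"
  shows "(\<Sum>k<n. Tmat n $$ (i, k) * f k) = f i - (\<Sum>k<n. f k) / of_nat n"
proof -
  have "(\<Sum>k<n. Tmat n $$ (i, k) * f k) = (\<Sum>k<n. (if k = i then f i else 0) - f k / of_nat n)"
    by (intro sum.cong) (use assms in \<open>auto simp: Tmat_def algebra_simps\<close>)
  then show ?thesis using assms by (simp add: sum_subtractf sum_divide_distrib)
qed

lemma index_Tmat_mult:
  assumes "A \<in> carrier_mat n n" "i < n" "j < n"
  shows "(Tmat n * A) $$ (i, j) = A $$ (i, j) - (\<Sum>k<n. A $$ (k, j)) / of_nat n"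
proof -
  have "(Tmat n * A) $$ (i, j) = (\<Sum>k<n. Tmat n $$ (i, k) * A $$ (k, j))"
    using assms Tmat_carrier[of n] by (auto simp: scalar_prod_def atLeast0LessThan intro!: sum.cong)
  then show ?thesis using index_Tmat_sum[OF assms(2)] by simp
qed

text \<open>Subtracting the mean is an orthogonal projection: it lowers the squared norm by exactly
  |s|^2 / n, where \<open>s\<close> is the sum of the coordinates.\<close>

lemma vnorm2_Tmat_le:
  assumes n: "1 \<le> n" and v: "v \<in> carrier_vec n"
  shows "vnorm2 (Tmat n *\<^sub>v v) \<le> vnorm2 v"
proof -
  define s where "s = (\<Sum>k<n. vec_index v k)"
  have expand: "(cmod (a - b))\<^sup>2 = (cmod a)\<^sup>2 - 2 * Re (a * cnj b) + (cmod b)\<^sup>2" for a b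
    unfolding cmod_power2 by (simp add: power2_eq_square algebra_simps)
  have "vnorm2 (Tmat n *\<^sub>v v) = (\<Sum>i<n. (cmod (vec_index v i - s / of_nat n))\<^sup>2)"
    unfolding vnorm2_def
    by (intro sum.cong)
      (use Tmat_carrier[of n] in \<open>simp_all add: index_mult_mat_vec_sum[OF Tmat_carrier v] index_Tmat_sum s_def
         del: index_mult_mat_vec\<close>)
  \<comment> \<open>For \<open>c\<close> the mean, the cross term contributes -2 |s|^2 / n and the
    last term |s|^2 / n.\<close>
  also have "\<dots> = vnorm2 v - 2 * Re (s * cnj c) + n * (cmod c)\<^sup>2" if "c = s / of_nat n" for c
  proof -
    have "(\<Sum>i<n. Re (vec_index v i * cnj c)) = Re (s * cnj c)"
      by (simp only: s_def sum_distrib_right Re_sum)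
    then show ?thesis
      unfolding expand that[symmetric] sum.distrib sum_subtractf sum_distrib_left[symmetric]
      using v by (simp add: vnorm2_def del: times_complex.sel)
  qed
  note this[OF refl]
  also have "s * cnj (s / of_nat n) = complex_of_real ((cmod s)\<^sup>2 / n)"
    by (simp add: complex_norm_square del: of_real_power)
  also have "n * (cmod (s / of_nat n))\<^sup>2 = (cmod s)\<^sup>2 / n"
    using n by (simp add: norm_divide power_divide power2_eq_square)
  finally have "vnorm2 (Tmat n *\<^sub>v v) = vnorm2 v - (cmod s)\<^sup>2 / n" by simp
  then show ?thesis by simp
qed

lemma sigma_max_Tmat_mult_le:
  assumes A: "A \<in> carrier_mat n n" and n: "1 \<le> n"
  shows "sigma_max (Tmat n * A) \<le> sigma_max A"
proof (rule sigma_max_leI[OF mult_carrier_mat[OF Tmat_carrier A] n])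
  show "0 \<le> sigma_max A" by (rule sigma_max_operator_norm(1)[OF A n])
  fix v :: "complex vec" assume v: "v \<in> carrier_vec n"
  have "vnorm2 (Tmat n * A *\<^sub>v v) = vnorm2 (Tmat n *\<^sub>v (A *\<^sub>v v))"
    by (simp add: assoc_mult_mat_vec[OF Tmat_carrier A v])
  also have "\<dots> \<le> vnorm2 (A *\<^sub>v v)" using A v by (intro vnorm2_Tmat_le[OF n]) auto
  also have "\<dots> \<le> (sigma_max A)\<^sup>2 * vnorm2 v" by (rule sigma_max_operator_norm(2)[OF A n v])
  finally show "vnorm2 (Tmat n * A *\<^sub>v v) \<le> (sigma_max A)\<^sup>2 * vnorm2 v" .
qed

section \<open>Essential suprema and frequency responses\<close>

text \<open>The upper bound makes the set of essential bounds nonempty. Nonnegativity of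
  \<open>g\<close> bounds it below, because a negative essential bound would make the whole line a
  null set. Its real infimum is thus meaningful, and it is itself an essential bound.\<close>

lemma
  assumes nonneg: "\<And>\<omega>. 0 \<le> g \<omega>" and bound: "AE \<omega> in lborel. g \<omega> \<le> c"
  shows ess_sup_nonneg: "0 \<le> ess_sup g"
    and ess_sup_le: "ess_sup g \<le> c"
    and AE_le_ess_sup: "AE \<omega> in lborel. g \<omega> \<le> ess_sup g"
proof -
  let ?S = "{c. AE \<omega> in lborel. g \<omega> \<le> c}"
  have lower: "0 \<le> x" if "x \<in> ?S" for x
  proof (rule ccontr)
    assume "\<not> 0 \<le> x"
    with that have "AE \<omega> in (lborel :: real measure). False"
      by (auto elim!: eventually_mono) (metis nonneg order_trans)
    then have "(UNIV :: real set) \<in> null_sets lborel" by (simp add: AE_iff_null_sets)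
    then show False by (simp add: null_sets_def)
  qed
  have bdd: "bdd_below ?S" using lower by (rule bdd_belowI)
  have c: "c \<in> ?S" using bound by simp
  show "0 \<le> ess_sup g" unfolding ess_sup_def using c lower by (intro cInf_greatest) auto
  show "ess_sup g \<le> c" unfolding ess_sup_def using c bdd by (rule cInf_lower)
  \<comment> \<open>The exceptional sets of these countably many levels have a null union; outside
    it the levels decrease to \<open>ess_sup g\<close>.\<close>
  have "AE \<omega> in lborel. g \<omega> \<le> ess_sup g + 1 / real (Suc k)" for k
  proof -
    have "Inf ?S < ess_sup g + 1 / real (Suc k)" by (simp add: ess_sup_def)
    then obtain x where "x \<in> ?S" "x < ess_sup g + 1 / real (Suc k)"
      using cInf_lessD[of ?S] c by blast
    then show ?thesis by (auto elim!: eventually_mono)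
  qed
  then have "AE \<omega> in lborel. \<forall>k. g \<omega> \<le> ess_sup g + 1 / real (Suc k)"
    by (simp add: AE_all_countable)
  then show "AE \<omega> in lborel. g \<omega> \<le> ess_sup g"
  proof eventually_elim
    case (elim \<omega>)
    show ?case
    proof (rule field_le_epsilon)
      fix e :: real assume "0 < e"
      then obtain k where "1 / real (Suc k) < e" using nat_approx_posE by metis
      moreover have "g \<omega> \<le> ess_sup g + 1 / real (Suc k)" using elim by blast
      ultimately show "g \<omega> \<le> ess_sup g + e" by linarith
    qed
  qed
qed

text \<open>Where the radial limit does not exist, \<open>freq_resp\<close> takes the fixed junk value
  \<open>THE l. False\<close>, so boundedness on the disc bounds it everywhere and Fatou's theorem is
  not needed.\<close>

lemma freq_resp_bounded:
  assumes "stable_sys M"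
  obtains C where "\<And>\<omega>. cmod (freq_resp M \<omega>) \<le> C"
proof -
  obtain B where B: "\<And>z. cmod z < 1 \<Longrightarrow> cmod (transfer_fun M z) \<le> B"
    using assms unfolding stable_sys_def bounded_iff by (metis imageI dist_0_norm mem_ball)
  have "cmod (freq_resp M \<omega>) \<le> max B (cmod (THE l. False))" for \<omega>
  proof (cases "\<exists>l. ((\<lambda>r. transfer_fun M (complex_of_real r * cis \<omega>)) \<longlongrightarrow> l) (at_left 1)")
    case True
    then obtain l where l: "((\<lambda>r. transfer_fun M (complex_of_real r * cis \<omega>)) \<longlongrightarrow> l) (at_left 1)" by blast
    then have "freq_resp M \<omega> = l"
      unfolding freq_resp_def by (intro tendsto_Lim) auto
    moreover have "\<forall>\<^sub>F r in at_left 1. cmod (transfer_fun M (complex_of_real r * cis \<omega>)) \<le> B"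
      using eventually_at_left_real[of 0 1]
      by (auto simp: norm_mult intro!: B elim!: eventually_mono)
    ultimately have "cmod (freq_resp M \<omega>) \<le> B"
      using tendsto_upperbound[OF tendsto_norm[OF l]] by simp
    then show ?thesis by simp
  next
    case False
    then show ?thesis by (simp add: freq_resp_def Topological_Spaces.Lim_def)
  qed
  then show ?thesis by (rule that)
qed

lemma
  assumes "stable_sys M"
  shows sys_norm_nonneg: "0 \<le> sys_norm M"
    and AE_freq_resp_le: "AE \<omega> in lborel. cmod (freq_resp M \<omega>) \<le> sys_norm M"
proof -
  obtain C where C: "\<And>\<omega>. cmod (freq_resp M \<omega>) \<le> C" using freq_resp_bounded[OF assms] by blast
  show "0 \<le> sys_norm M"
    unfolding sys_norm_def by (rule ess_sup_nonneg[of _ C]) (use C in auto)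
  show "AE \<omega> in lborel. cmod (freq_resp M \<omega>) \<le> sys_norm M"
    unfolding sys_norm_def by (rule AE_le_ess_sup[of _ C]) (use C in auto)
qed

lemma stable_sys_zero: "stable_sys (\<lambda>k. 0)"
  by (auto simp: stable_sys_def transfer_fun_def bounded_iff)

lemma freq_resp_zero: "freq_resp (\<lambda>k. 0) \<omega> = 0"
  by (simp add: freq_resp_def transfer_fun_def tendsto_Lim)

lemma sys_norm_zero: "sys_norm (\<lambda>k. 0) = 0"
  using sys_norm_nonneg[OF stable_sys_zero] ess_sup_le[of "\<lambda>\<omega>. 0" 0]
  by (simp add: sys_norm_def freq_resp_zero)

section \<open>Closed-loop norms\<close>

text \<open>With \<open>n\<close> equal to the size of \<open>Q\<close> this decentralizes the
  controller; with a smaller \<open>n\<close> it also keeps only the first \<open>n\<close>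
  agents.\<close>

definition diag_part :: "nat \<Rightarrow> sys mat \<Rightarrow> sys mat" where
  "diag_part n Q = Matrix.mat n n (\<lambda>(i, j). if i = j then Q $$ (i, i) else (\<lambda>k. 0))"

lemma index_diag_part:
  assumes "i < n" "j < n"
  shows "diag_part n Q $$ (i, j) = (if i = j then Q $$ (i, i) else (\<lambda>k. 0))"
  using assms by (simp add: diag_part_def)

text \<open>The off-diagonal sums vanish, so dominance only asks that \<alpha> be positive at
  \<open>n\<close>; the values of \<alpha> at \<open>n\<close> and \<open>m\<close> may be
  unrelated.\<close>

lemma diag_part_Qset:
  assumes Q: "Q \<in> Qset \<alpha> \<gamma> m" and nm: "n \<le> m" and \<alpha>: "0 < \<alpha> n"
  shows "diag_part n Q \<in> Qset \<alpha> \<gamma> n"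
proof -
  have "0 \<le> sys_norm (Q $$ (j, j))" if "j < n" for j
    using Q nm that by (auto simp: Qset_def intro!: sys_norm_nonneg)
  then have "column_dominant (\<alpha> n) n (diag_part n Q)"
    using \<alpha> by (simp add: column_dominant_def index_diag_part sys_norm_zero)
  then show ?thesis
    using Q nm by (auto simp: Qset_def index_diag_part stable_sys_zero) (simp add: diag_part_def)
qed

lemma Phi_carrier: "Q \<in> carrier_mat n n \<Longrightarrow> Phi H U V n Q \<omega> \<in> carrier_mat n n"
  unfolding Phi_def diag_resp_def by (intro minus_carrier_mat mult_carrier_mat mat_diag_dim) auto

lemma Psi_carrier: "Q \<in> carrier_mat n n \<Longrightarrow> Psi H U V n Q \<omega> \<in> carrier_mat n n"
  unfolding Psi_def using Tmat_carrier Phi_carrier by (rule mult_carrier_mat)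

lemma index_Phi:
  assumes Q: "Q \<in> carrier_mat n n" and "i < n" "j < n"
  shows "Phi H U V n Q \<omega> $$ (i, j) = (if i = j then freq_resp (H i) \<omega> else 0)
    - freq_resp (U i) \<omega> * freq_resp (Q $$ (i, j)) \<omega> * freq_resp (V j) \<omega>"
proof -
  have Q': "map_mat (\<lambda>M. freq_resp M \<omega>) Q \<in> carrier_mat n n" using Q by simp
  show ?thesis
    unfolding Phi_def diag_resp_def mat_diag_mult_left[OF Q']
    by (subst mat_diag_mult_right[of _ n n]) (use assms in \<open>auto simp: mat_diag_def\<close>)
qed

text \<open>Since the \<open>H\<close>, \<open>U\<close> and \<open>V\<close> blocks are diagonal,
  the \<open>i\<close>-th diagonal entry of the closed loop sees only the \<open>i\<close>-th
  diagonal entry of \<open>Q\<close>. Dropping the other entries of \<open>Q\<close> leaves it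
  unchanged.\<close>

lemma Phi_diag_part:
  assumes Q: "Q \<in> carrier_mat m m" and nm: "n \<le> m"
  shows "Phi H U V n (diag_part n Q) \<omega> = mat_diag n (\<lambda>i. Phi H U V m Q \<omega> $$ (i, i))"
proof -
  have D: "diag_part n Q \<in> carrier_mat n n" by (simp add: diag_part_def)
  show ?thesis
    using carrier_matD[OF Phi_carrier[OF D, of H U V \<omega>]] nm
    by (intro eq_matI)
      (auto simp: index_Phi[OF D] index_Phi[OF Q] index_diag_part freq_resp_zero mat_diag_def)
qed

text \<open>Provides the finite bound, uniform in the frequency, that the facts on
  \<open>ess_sup\<close> require.\<close>

lemma Phi_bounded:
  assumes Q: "Q \<in> carrier_mat n n"
    and stable: "\<And>i j. i < n \<Longrightarrow> j < n \<Longrightarrow> stable_sys (Q $$ (i, j))"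
    and HUV: "\<And>i. stable_sys (H i)" "\<And>i. stable_sys (U i)" "\<And>i. stable_sys (V i)"
    and n: "1 \<le> n"
  obtains C where "\<And>\<omega>. sigma_max (Phi H U V n Q \<omega>) \<le> C"
proof -
  have "\<forall>i j. \<exists>c. i < n \<longrightarrow> j < n \<longrightarrow> (\<forall>\<omega>. cmod (Phi H U V n Q \<omega> $$ (i, j)) \<le> c)"
  proof (intro allI)
    fix i j
    show "\<exists>c. i < n \<longrightarrow> j < n \<longrightarrow> (\<forall>\<omega>. cmod (Phi H U V n Q \<omega> $$ (i, j)) \<le> c)"
    proof (cases "i < n \<and> j < n")
      case ij: True
      obtain h u v q where h: "\<And>\<omega>. cmod (freq_resp (H i) \<omega>) \<le> h"
        and u: "\<And>\<omega>. cmod (freq_resp (U i) \<omega>) \<le> u"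
        and v: "\<And>\<omega>. cmod (freq_resp (V j) \<omega>) \<le> v"
        and q: "\<And>\<omega>. cmod (freq_resp (Q $$ (i, j)) \<omega>) \<le> q"
        using freq_resp_bounded HUV stable ij by metis
      have "cmod (Phi H U V n Q \<omega> $$ (i, j)) \<le> h + u * q * v" for \<omega>
      proof -
        have "cmod (Phi H U V n Q \<omega> $$ (i, j)) \<le> cmod (freq_resp (H i) \<omega>)
          + cmod (freq_resp (U i) \<omega>) * cmod (freq_resp (Q $$ (i, j)) \<omega>) * cmod (freq_resp (V j) \<omega>)"
          using ij by (auto simp: index_Phi[OF Q] norm_mult[symmetric] intro: order_trans[OF norm_triangle_ineq4])
        also have "\<dots> \<le> h + u * q * v"
          by (intro add_mono mult_mono h u q v mult_nonneg_nonneg norm_ge_zero order_trans[OF norm_ge_zero u]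
              order_trans[OF norm_ge_zero q])
        finally show ?thesis .
      qed
      then show ?thesis by blast
    qed auto
  qed
  then obtain c where c: "\<And>i j \<omega>. i < n \<Longrightarrow> j < n \<Longrightarrow> cmod (Phi H U V n Q \<omega> $$ (i, j)) \<le> c i j"
    by metis
  have le: "cmod (Phi H U V n Q \<omega> $$ (i, j)) \<le> (\<Sum>i<n. \<Sum>j<n. c i j)" if ij: "i < n" "j < n" for i j \<omega>
  proof -
    have c0: "0 \<le> c i j" if "i < n" "j < n" for i j
      using c[OF that] norm_ge_zero order_trans by blast
    have "c i j \<le> (\<Sum>j<n. c i j)" using ij c0 by (intro member_le_sum) auto
    also have "\<dots> \<le> (\<Sum>i<n. \<Sum>j<n. c i j)"
      using ij c0 by (intro member_le_sum[of i _ "\<lambda>i. \<Sum>j<n. c i j"]) (auto intro!: sum_nonneg)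
    finally show ?thesis using c[OF ij, of \<omega>] by linarith
  qed
  show ?thesis
    by (rule that, rule sigma_max_le_entries[OF Phi_carrier[OF Q] n], rule le)
qed

section \<open>Comparison of the two optimal values\<close>

context
  fixes H U V :: "nat \<Rightarrow> sys" and \<gamma> \<alpha> :: "nat \<Rightarrow> real"
  assumes HUV: "\<And>i. stable_sys (H i)" "\<And>i. stable_sys (U i)" "\<And>i. stable_sys (V i)"
begin

lemma
  assumes Q: "Q \<in> Qset \<alpha> \<gamma> n" and n: "1 \<le> n"
  shows hinf_norm_Phi_nonneg: "0 \<le> hinf_norm (Phi H U V n Q)"
    and AE_sigma_max_Phi_le: "AE \<omega> in lborel. sigma_max (Phi H U V n Q \<omega>) \<le> hinf_norm (Phi H U V n Q)"
    and hinf_norm_Psi_nonneg: "0 \<le> hinf_norm (Psi H U V n Q)"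
    and AE_sigma_max_Psi_le: "AE \<omega> in lborel. sigma_max (Psi H U V n Q \<omega>) \<le> hinf_norm (Psi H U V n Q)"
    and hinf_norm_Psi_le: "hinf_norm (Psi H U V n Q) \<le> hinf_norm (Phi H U V n Q)"
proof -
  have Qc: "Q \<in> carrier_mat n n" using Q by (simp add: Qset_def)
  obtain C where C: "\<And>\<omega>. sigma_max (Phi H U V n Q \<omega>) \<le> C"
    by (rule Phi_bounded[where H = H and U = U and V = V, OF Qc _ HUV n])
      (use Q in \<open>auto simp: Qset_def\<close>)
  have le: "sigma_max (Psi H U V n Q \<omega>) \<le> sigma_max (Phi H U V n Q \<omega>)" for \<omega>
    unfolding Psi_def by (rule sigma_max_Tmat_mult_le[OF Phi_carrier[OF Qc] n])
  have C': "\<And>\<omega>. sigma_max (Psi H U V n Q \<omega>) \<le> C" using le C order_trans by blast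
  note Phi = sigma_max_operator_norm(1)[OF Phi_carrier[OF Qc] n]
  note Psi = sigma_max_operator_norm(1)[OF Psi_carrier[OF Qc] n]
  show "0 \<le> hinf_norm (Phi H U V n Q)"
    unfolding hinf_norm_def by (rule ess_sup_nonneg[of _ C]) (use C Phi in auto)
  show *: "AE \<omega> in lborel. sigma_max (Phi H U V n Q \<omega>) \<le> hinf_norm (Phi H U V n Q)"
    unfolding hinf_norm_def by (rule AE_le_ess_sup[of _ C]) (use C Phi in auto)
  show "0 \<le> hinf_norm (Psi H U V n Q)"
    unfolding hinf_norm_def by (rule ess_sup_nonneg[of _ C]) (use C' Psi in auto)
  show "AE \<omega> in lborel. sigma_max (Psi H U V n Q \<omega>) \<le> hinf_norm (Psi H U V n Q)"
    unfolding hinf_norm_def by (rule AE_le_ess_sup[of _ C]) (use C' Psi in auto)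
  show "hinf_norm (Psi H U V n Q) \<le> hinf_norm (Phi H U V n Q)"
    unfolding hinf_norm_def[of "Psi H U V n Q"]
  proof (rule ess_sup_le)
    show "AE \<omega> in lborel. sigma_max (Psi H U V n Q \<omega>) \<le> hinf_norm (Phi H U V n Q)"
      using * by eventually_elim (use le order_trans in blast)
  qed (rule Psi)
qed

lemma hinf_norm_Phi_diag_part_le:
  assumes Q: "Q \<in> carrier_mat m m" and n: "1 \<le> n" "n \<le> m"
    and c: "AE \<omega> in lborel. \<forall>i<n. cmod (Phi H U V m Q \<omega> $$ (i, i)) \<le> c"
  shows "hinf_norm (Phi H U V n (diag_part n Q)) \<le> c"
  unfolding hinf_norm_def Phi_diag_part[OF Q n(2)]
proof (rule ess_sup_le)
  show "0 \<le> sigma_max (mat_diag n (\<lambda>i. Phi H U V m Q \<omega> $$ (i, i)))" for \<omega>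
    by (rule sigma_max_operator_norm(1)[OF mat_diag_dim n(1)])
  show "AE \<omega> in lborel. sigma_max (mat_diag n (\<lambda>i. Phi H U V m Q \<omega> $$ (i, i))) \<le> c"
    using c by eventually_elim (intro sigma_max_mat_diag_le n(1), simp)
qed

lemma mu_opt_le:
  assumes "Q \<in> Qset \<alpha> \<gamma> n" "1 \<le> n"
  shows "mu_opt H U V \<alpha> \<gamma> n \<le> hinf_norm (Phi H U V n Q)"
  unfolding mu_opt_def using assms hinf_norm_Phi_nonneg
  by (intro cINF_lower bdd_belowI[of _ 0]) auto

lemma psi_opt_le:
  assumes "Q \<in> Qset \<alpha> \<gamma> n" "1 \<le> n"
  shows "psi_opt H U V \<alpha> \<gamma> n \<le> hinf_norm (Psi H U V n Q)"
  unfolding psi_opt_def using assms hinf_norm_Psi_nonneg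
  by (intro cINF_lower bdd_belowI[of _ 0]) auto

text \<open>The diagonal of an optimal \<open>Z\<close> for \<open>m\<close> agents, cut down to the
  first \<open>n\<close>, is feasible for \<open>n\<close> agents. Its closed loop is diagonal, with
  entries bounded by the norm achieved by \<open>Z\<close>.\<close>

lemma mu_opt_mono:
  assumes Z: "mu_solution H U V \<alpha> \<gamma> m Z" and n: "1 \<le> n" "n \<le> m" and \<alpha>: "0 < \<alpha> n"
  shows "mu_opt H U V \<alpha> \<gamma> n \<le> mu_opt H U V \<alpha> \<gamma> m"
proof -
  have ZQ: "Z \<in> Qset \<alpha> \<gamma> m" using Z by (simp add: mu_solution_def)
  then have Zc: "Z \<in> carrier_mat m m" by (simp add: Qset_def)
  have "mu_opt H U V \<alpha> \<gamma> n \<le> hinf_norm (Phi H U V n (diag_part n Z))"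
    by (rule mu_opt_le[OF diag_part_Qset[of _ \<alpha> \<gamma> m]]) (use ZQ n \<alpha> in auto)
  also have "\<dots> \<le> hinf_norm (Phi H U V m Z)"
  proof (rule hinf_norm_Phi_diag_part_le[OF Zc n])
    have "AE \<omega> in lborel. sigma_max (Phi H U V m Z \<omega>) \<le> hinf_norm (Phi H U V m Z)"
      using AE_sigma_max_Phi_le[OF ZQ] n by simp
    then show "AE \<omega> in lborel. \<forall>i<n. cmod (Phi H U V m Z \<omega> $$ (i, i)) \<le> hinf_norm (Phi H U V m Z)"
    proof eventually_elim
      case (elim \<omega>)
      have "cmod (Phi H U V m Z \<omega> $$ (i, i)) \<le> sigma_max (Phi H U V m Z \<omega>)" if "i < n" for i
        by (rule cmod_index_le_sigma_max[OF Phi_carrier[OF Zc]]) (use that n(2) in auto)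
      with elim show ?case by (auto intro: order_trans)
    qed
  qed
  finally show ?thesis using Z by (simp add: mu_solution_def)
qed

text \<open>The error term bounds the modulus of a column average of the closed loop:
  \<open>\<gamma>h\<close> comes from \<open>H\<close>, and the rest from the sum of the norms in
  one column of \<open>Q\<close>.\<close>

lemma hinf_norm_Phi_diag_part_le_Psi:
  assumes Q: "Q \<in> Qset \<alpha> \<gamma> n" and n: "1 \<le> n" and \<alpha>: "0 < \<alpha> n"
    and bounds: "\<And>i. sys_norm (H i) \<le> \<gamma>h" "\<And>i. sys_norm (U i) \<le> \<gamma>u" "\<And>i. sys_norm (V i) \<le> \<gamma>v"
    and \<Gamma>: "\<And>i. \<gamma> i \<le> \<Gamma>"
  shows "hinf_norm (Phi H U V n (diag_part n Q))
    \<le> hinf_norm (Psi H U V n Q) + (\<gamma>h + \<gamma>u * \<gamma>v * ((1 + \<alpha> n) * \<Gamma>)) / n"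
proof (rule hinf_norm_Phi_diag_part_le)
  have Qc: "Q \<in> carrier_mat n n" using Q by (simp add: Qset_def)
  then show "Q \<in> carrier_mat n n" .
  have stable: "stable_sys (Q $$ (i, j))" if "i < n" "j < n" for i j
    using Q that by (simp add: Qset_def)
  have "0 \<le> \<gamma>u" "0 \<le> \<gamma>v"
    using order_trans[OF sys_norm_nonneg[OF HUV(2)] bounds(2)]
      order_trans[OF sys_norm_nonneg[OF HUV(3)] bounds(3)] by simp_all
  then have uv: "0 \<le> \<gamma>u" "0 \<le> \<gamma>v" "0 \<le> \<gamma>u * \<gamma>v" by simp_all
  \<comment> \<open>Column dominance enters here: the off-diagonal norms of column \<open>i\<close>
    add up to at most \<open>\<alpha> n\<close> times the diagonal one.\<close>
  have column: "(\<Sum>k<n. sys_norm (Q $$ (k, i))) \<le> (1 + \<alpha> n) * \<Gamma>" if i: "i < n" for i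
  proof -
    have "(\<Sum>k<n. sys_norm (Q $$ (k, i))) = sys_norm (Q $$ (i, i)) + (\<Sum>k\<in>{..<n} - {i}. sys_norm (Q $$ (k, i)))"
      using i by (simp add: sum.remove)
    also have "\<dots> \<le> (1 + \<alpha> n) * sys_norm (Q $$ (i, i))"
      using Q i by (simp add: Qset_def column_dominant_def distrib_right)
    also have "\<dots> \<le> (1 + \<alpha> n) * \<Gamma>"
      using Q i \<alpha> \<Gamma>[of i] by (intro mult_left_mono) (auto simp: Qset_def intro: order_trans)
    finally show ?thesis .
  qed
  \<comment> \<open>All bounds are collected on one set of full measure, so that the remaining
    estimate can be made at a single frequency.\<close>
  have "AE \<omega> in lborel. \<forall>i. i < n \<longrightarrow> (\<forall>j. j < n \<longrightarrow> cmod (freq_resp (Q $$ (i, j)) \<omega>) \<le> sys_norm (Q $$ (i, j)))"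
  proof (unfold AE_all_countable, intro allI)
    fix i
    show "AE \<omega> in lborel. i < n \<longrightarrow> (\<forall>j. j < n \<longrightarrow> cmod (freq_resp (Q $$ (i, j)) \<omega>) \<le> sys_norm (Q $$ (i, j)))"
    proof (cases "i < n")
      case True
      have "AE \<omega> in lborel. \<forall>j. j < n \<longrightarrow> cmod (freq_resp (Q $$ (i, j)) \<omega>) \<le> sys_norm (Q $$ (i, j))"
        unfolding AE_all_countable using AE_freq_resp_le stable True by auto
      then show ?thesis by eventually_elim simp
    qed simp
  qed
  moreover have "AE \<omega> in lborel. \<forall>i. cmod (freq_resp (H i) \<omega>) \<le> sys_norm (H i)"
    "AE \<omega> in lborel. \<forall>i. cmod (freq_resp (U i) \<omega>) \<le> sys_norm (U i)"
    "AE \<omega> in lborel. \<forall>i. cmod (freq_resp (V i) \<omega>) \<le> sys_norm (V i)"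
    unfolding AE_all_countable using HUV by (auto intro!: AE_freq_resp_le)
  moreover note AE_sigma_max_Psi_le[OF Q n]
  ultimately show "AE \<omega> in lborel. \<forall>i<n. cmod (Phi H U V n Q \<omega> $$ (i, i))
    \<le> hinf_norm (Psi H U V n Q) + (\<gamma>h + \<gamma>u * \<gamma>v * ((1 + \<alpha> n) * \<Gamma>)) / n"
  proof eventually_elim
    case (elim \<omega>)
    define P where "P = Phi H U V n Q \<omega>"
    have "cmod (P $$ (i, i)) \<le> hinf_norm (Psi H U V n Q) + (\<gamma>h + \<gamma>u * \<gamma>v * ((1 + \<alpha> n) * \<Gamma>)) / n"
      if i: "i < n" for i
    proof -
      \<comment> \<open>\<open>H\<close> meets column \<open>i\<close> only at \<open>k = i\<close>,
        so it contributes \<open>\<gamma>h\<close> to the column sum once and not \<open>n\<close>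
        times.\<close>
      have entry: "cmod (P $$ (k, i)) \<le> (if k = i then \<gamma>h else 0) + \<gamma>u * \<gamma>v * sys_norm (Q $$ (k, i))"
        if k: "k < n" for k
      proof -
        have "cmod (P $$ (k, i)) \<le> cmod (if k = i then freq_resp (H k) \<omega> else 0)
          + cmod (freq_resp (U k) \<omega>) * cmod (freq_resp (V i) \<omega>) * cmod (freq_resp (Q $$ (k, i)) \<omega>)"
          unfolding P_def index_Phi[OF Qc k i]
          by (rule order_trans[OF norm_triangle_ineq4]) (simp add: norm_mult mult_ac)
        also have "cmod (if k = i then freq_resp (H k) \<omega> else 0) \<le> (if k = i then \<gamma>h else 0)"
          using elim(2) by (auto intro: order_trans[OF _ bounds(1)])
        also have "cmod (freq_resp (U k) \<omega>) * cmod (freq_resp (V i) \<omega>) * cmod (freq_resp (Q $$ (k, i)) \<omega>)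
            \<le> \<gamma>u * \<gamma>v * sys_norm (Q $$ (k, i))"
          using elim(1,3,4) bounds(2,3) uv k i
          by (intro mult_mono) (auto intro: order_trans)
        finally show ?thesis by simp
      qed
      have "cmod (\<Sum>k<n. P $$ (k, i)) \<le> (\<Sum>k<n. (if k = i then \<gamma>h else 0) + \<gamma>u * \<gamma>v * sys_norm (Q $$ (k, i)))"
        by (rule sum_norm_le) (use entry in simp)
      also have "\<dots> = \<gamma>h + \<gamma>u * \<gamma>v * (\<Sum>k<n. sys_norm (Q $$ (k, i)))"
        using i by (simp add: sum.distrib sum_distrib_left)
      also have "\<dots> \<le> \<gamma>h + \<gamma>u * \<gamma>v * ((1 + \<alpha> n) * \<Gamma>)"
        using column[OF i] uv(3) by (intro add_left_mono mult_left_mono)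
      finally have sum_le: "cmod (\<Sum>k<n. P $$ (k, i)) / n \<le> (\<gamma>h + \<gamma>u * \<gamma>v * ((1 + \<alpha> n) * \<Gamma>)) / n"
        by (rule divide_right_mono) simp
      have Pc: "P \<in> carrier_mat n n" unfolding P_def by (rule Phi_carrier[OF Qc])
      have "P $$ (i, i) = Psi H U V n Q \<omega> $$ (i, i) + (\<Sum>k<n. P $$ (k, i)) / of_nat n"
        using index_Tmat_mult[OF Pc i i] by (simp add: Psi_def P_def)
      then have "cmod (P $$ (i, i)) \<le> cmod (Psi H U V n Q \<omega> $$ (i, i)) + cmod (\<Sum>k<n. P $$ (k, i)) / n"
        using norm_triangle_ineq[of "Psi H U V n Q \<omega> $$ (i, i)" "(\<Sum>k<n. P $$ (k, i)) / of_nat n"]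
        by (simp add: norm_divide)
      moreover have "cmod (Psi H U V n Q \<omega> $$ (i, i)) \<le> hinf_norm (Psi H U V n Q)"
        using cmod_index_le_sigma_max[OF Psi_carrier[OF Qc] i i, of H U V \<omega>] elim(5) by linarith
      ultimately show ?thesis using sum_le by linarith
    qed
    then show ?case by (simp add: P_def)
  qed
qed (use n in auto)

lemma mu_opt_le_psi_opt:
  assumes n: "1 \<le> n" and \<alpha>: "0 < \<alpha> n" and ne: "Qset \<alpha> \<gamma> n \<noteq> {}"
    and bounds: "\<And>i. sys_norm (H i) \<le> \<gamma>h" "\<And>i. sys_norm (U i) \<le> \<gamma>u" "\<And>i. sys_norm (V i) \<le> \<gamma>v"
    and \<Gamma>: "\<And>i. \<gamma> i \<le> \<Gamma>"
  shows "mu_opt H U V \<alpha> \<gamma> n \<le> psi_opt H U V \<alpha> \<gamma> n + (\<gamma>h + \<gamma>u * \<gamma>v * ((1 + \<alpha> n) * \<Gamma>)) / n"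
proof -
  \<comment> \<open>With the error on the left, the inequality is a lower bound common to all
    feasible \<open>Q\<close> and passes to the infimum.\<close>
  have "mu_opt H U V \<alpha> \<gamma> n - (\<gamma>h + \<gamma>u * \<gamma>v * ((1 + \<alpha> n) * \<Gamma>)) / n \<le> psi_opt H U V \<alpha> \<gamma> n"
    unfolding psi_opt_def
  proof (rule cINF_greatest[OF ne])
    fix Q assume Q: "Q \<in> Qset \<alpha> \<gamma> n"
    show "mu_opt H U V \<alpha> \<gamma> n - (\<gamma>h + \<gamma>u * \<gamma>v * ((1 + \<alpha> n) * \<Gamma>)) / n \<le> hinf_norm (Psi H U V n Q)"
      using mu_opt_le[OF diag_part_Qset[of Q \<alpha> \<gamma> n n] n, OF Q order_refl \<alpha>]
        hinf_norm_Phi_diag_part_le_Psi[OF Q n \<alpha> bounds \<Gamma>] by simp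
  qed
  then show ?thesis by simp
qed

text \<open>With \<open>Q = 0\<close> the closed loop is \<open>H\<close> itself. The bound is
  independent of \<open>n\<close>, as monotone convergence requires.\<close>

lemma mu_opt_le_bound:
  assumes n: "1 \<le> n" and \<alpha>: "0 < \<alpha> n" and \<gamma>: "\<And>i. 0 < \<gamma> i"
    and H: "\<And>i. sys_norm (H i) \<le> \<gamma>h"
  shows "mu_opt H U V \<alpha> \<gamma> n \<le> \<gamma>h"
proof -
  define Q0 :: "sys mat" where "Q0 = Matrix.mat n n (\<lambda>(i, j) k. 0)"
  have idx: "Q0 $$ (i, j) = (\<lambda>k. 0)" if "i < n" "j < n" for i j using that by (simp add: Q0_def)
  have Q0c: "Q0 \<in> carrier_mat n n" by (simp add: Q0_def)
  have "Q0 \<in> Qset \<alpha> \<gamma> n"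
    using Q0c \<gamma> by (auto simp: Qset_def column_dominant_def idx stable_sys_zero sys_norm_zero less_imp_le)
  note D = diag_part_Qset[of Q0 \<alpha> \<gamma> n n, OF this order_refl \<alpha>]
  have "hinf_norm (Phi H U V n (diag_part n Q0)) \<le> \<gamma>h"
  proof (rule hinf_norm_Phi_diag_part_le[OF Q0c n order_refl])
    have "AE \<omega> in lborel. \<forall>i. cmod (freq_resp (H i) \<omega>) \<le> sys_norm (H i)"
      unfolding AE_all_countable using HUV by (auto intro!: AE_freq_resp_le)
    then show "AE \<omega> in lborel. \<forall>i<n. cmod (Phi H U V n Q0 \<omega> $$ (i, i)) \<le> \<gamma>h"
      by eventually_elim (auto simp: index_Phi[OF Q0c] idx freq_resp_zero intro: order_trans[OF _ H])
  qed
  then show ?thesis using mu_opt_le[OF D n] by simp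
qed

end

section \<open>Convergence and asymptotic optimality\<close>

theorem theorem1:
  fixes H U V :: "nat \<Rightarrow> sys"
    and \<gamma>h \<gamma>u \<gamma>v :: real
    and \<gamma> \<alpha> :: "nat \<Rightarrow> real"
  assumes "\<And>i. stable_sys (H i)" and "\<And>i. stable_sys (U i)" and "\<And>i. stable_sys (V i)"
    and "\<And>i. sys_norm (H i) \<le> \<gamma>h"
    and "\<And>i. sys_norm (U i) \<le> \<gamma>u"
    and "\<And>i. sys_norm (V i) \<le> \<gamma>v"
    and "\<And>i. 0 < \<gamma> i" and "bdd_above (range \<gamma>)"
    and "\<And>n. 1 \<le> n \<Longrightarrow> 0 < \<alpha> n"
    and "\<alpha> \<in> o(\<lambda>n. sqrt (real n))"
    and attained: "\<And>M. 1 \<le> M \<Longrightarrow> \<exists>Z. mu_solution H U V \<alpha> \<gamma> M Z"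
  shows "((\<lambda>n. ereal (psi_opt H U V \<alpha> \<gamma> n)) \<longlonglongrightarrow> limsup (\<lambda>M. ereal (mu_opt H U V \<alpha> \<gamma> M))) \<and>
    (\<forall>Z. (\<forall>M\<ge>1. mu_solution H U V \<alpha> \<gamma> M (Z M) \<and> diagonal_sys (Z M)) \<longrightarrow>
      (\<forall>\<epsilon>>0. \<exists>M0. \<forall>M\<ge>M0.
         hinf_norm (Psi H U V M (Z M)) \<le> psi_opt H U V \<alpha> \<gamma> M + \<epsilon>))"
proof -
  note HUV = assms(1-3) and bounds = assms(4-6) and \<gamma>_pos = assms(7) and \<alpha>_pos = assms(9)
  obtain \<Gamma> where \<Gamma>: "\<And>i. \<gamma> i \<le> \<Gamma>" using assms(8) by (auto simp: bdd_above_def)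
  let ?\<mu> = "mu_opt H U V \<alpha> \<gamma>" and ?\<psi> = "psi_opt H U V \<alpha> \<gamma>"
  \<comment> \<open>The gap between the two optimal values; it tends to 0 because both
    \<open>1 / n\<close> and \<open>\<alpha> n / n\<close> do.\<close>
  define \<delta> where "\<delta> n = (\<gamma>h + \<gamma>u * \<gamma>v * ((1 + \<alpha> n) * \<Gamma>)) / real n" for n
  have "\<alpha> \<in> o(\<lambda>n. real n)"
  proof (rule landau_o.small_big_trans[OF assms(10)])
    have "(\<lambda>n::nat. sqrt (real n)) \<in> O(\<lambda>n. real n)" by real_asymp
    then show "(\<lambda>n. sqrt (real n)) \<in> O(\<lambda>n. real n)" .
  qed
  then have "(\<lambda>n. \<alpha> n / real n) \<longlonglongrightarrow> 0" by (rule smalloD_tendsto)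
  then have "(\<lambda>n. (\<gamma>h + \<gamma>u * \<gamma>v * \<Gamma>) * (1 / real n) + \<gamma>u * \<gamma>v * \<Gamma> * (\<alpha> n / real n))
      \<longlonglongrightarrow> (\<gamma>h + \<gamma>u * \<gamma>v * \<Gamma>) * 0 + \<gamma>u * \<gamma>v * \<Gamma> * 0"
    by (intro tendsto_intros lim_1_over_n)
  then have \<delta>: "\<delta> \<longlonglongrightarrow> 0"
    by (simp add: \<delta>_def[abs_def] add_divide_distrib algebra_simps)
  have lower: "?\<mu> n \<le> ?\<psi> n + \<delta> n" if n: "1 \<le> n" for n
  proof -
    have "Qset \<alpha> \<gamma> n \<noteq> {}" using attained[OF n] by (auto simp: mu_solution_def)
    then show ?thesis
      unfolding \<delta>_def using mu_opt_le_psi_opt[where H = H and U = U and V = V and \<gamma> = \<gamma> and \<alpha> = \<alpha>,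
        OF HUV n \<alpha>_pos[OF n] _ bounds \<Gamma>] by blast
  qed
  have Psi_Z: "hinf_norm (Psi H U V n Z) \<le> ?\<mu> n" if "mu_solution H U V \<alpha> \<gamma> n Z" "1 \<le> n" for n Z
    using that hinf_norm_Psi_le[where H = H and U = U and V = V, OF HUV, of Z \<alpha> \<gamma> n] by (simp add: mu_solution_def)
  have upper: "?\<psi> n \<le> ?\<mu> n" if n: "1 \<le> n" for n
  proof -
    obtain Z where Z: "mu_solution H U V \<alpha> \<gamma> n Z" using attained[OF n] by blast
    then have "?\<psi> n \<le> hinf_norm (Psi H U V n Z)"
      using psi_opt_le[where H = H and U = U and V = V, OF HUV _ n] by (simp add: mu_solution_def)
    then show ?thesis using Psi_Z[OF Z n] by simp
  qed
  \<comment> \<open>The shift starts the sequence at one agent, since positivity of \<alpha> and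
    attainment are assumed from there on.\<close>
  have "incseq (\<lambda>n. ?\<mu> (Suc n))"
  proof (rule incseq_SucI)
    fix n
    obtain Z where "mu_solution H U V \<alpha> \<gamma> (Suc (Suc n)) Z" using attained by fastforce
    from mu_opt_mono[where H = H and U = U and V = V, OF HUV this, of "Suc n"] show "?\<mu> (Suc n) \<le> ?\<mu> (Suc (Suc n))"
      using \<alpha>_pos by simp
  qed
  moreover have "?\<mu> (Suc n) \<le> \<gamma>h" for n
    using mu_opt_le_bound[where H = H and U = U and V = V and \<alpha> = \<alpha>, OF HUV _ _ \<gamma>_pos bounds(1)] \<alpha>_pos by simp
  ultimately obtain L where "(\<lambda>n. ?\<mu> (Suc n)) \<longlonglongrightarrow> L"
    using incseq_convergent[of "\<lambda>n. ?\<mu> (Suc n)" \<gamma>h] by blast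
  then have L: "?\<mu> \<longlonglongrightarrow> L" by (simp add: filterlim_sequentially_Suc)
  \<comment> \<open>Monotonicity has turned the upper limit into a genuine limit, so the squeeze
    between \<open>?\<mu> n - \<delta> n\<close> and \<open>?\<mu> n\<close> applies.\<close>
  then have limsup: "limsup (\<lambda>n. ereal (?\<mu> n)) = ereal L"
    by (intro lim_imp_Limsup) auto
  have "?\<psi> \<longlonglongrightarrow> L"
  proof (rule tendsto_sandwich)
    show "(\<lambda>n. ?\<mu> n - \<delta> n) \<longlonglongrightarrow> L" using tendsto_diff[OF L \<delta>] by simp
    show "\<forall>\<^sub>F n in sequentially. ?\<mu> n - \<delta> n \<le> ?\<psi> n"
      using eventually_ge_at_top[of 1] by eventually_elim (use lower in \<open>auto simp: algebra_simps\<close>)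
    show "\<forall>\<^sub>F n in sequentially. ?\<psi> n \<le> ?\<mu> n"
      using eventually_ge_at_top[of 1] by eventually_elim (use upper in auto)
  qed (rule L)
  moreover have "\<exists>M0. \<forall>M\<ge>M0. hinf_norm (Psi H U V M (Z M)) \<le> ?\<psi> M + \<epsilon>"
    if Z: "\<forall>M\<ge>1. mu_solution H U V \<alpha> \<gamma> M (Z M) \<and> diagonal_sys (Z M)" and \<epsilon>: "0 < \<epsilon>" for Z and \<epsilon> :: real
  proof -
    obtain N where N: "\<And>n. n \<ge> N \<Longrightarrow> \<delta> n < \<epsilon>"
      using order_tendstoD(2)[OF \<delta> \<epsilon>] by (auto simp: eventually_sequentially)
    \<comment> \<open>The chain is: the norm of \<open>Psi\<close> at \<open>Z M\<close> is at most
      \<open>?\<mu> M\<close>, which is at most \<open>?\<psi> M + \<delta> M\<close>, and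
      \<open>\<delta> M < \<epsilon>\<close> from \<open>N\<close> on.\<close>
    have "hinf_norm (Psi H U V M (Z M)) \<le> ?\<psi> M + \<epsilon>" if "M \<ge> max 1 N" for M
      using Psi_Z[of M "Z M"] lower[of M] N[of M] Z that by fastforce
    then show ?thesis by blast
  qed
  ultimately show ?thesis by (simp add: limsup)
qed

end
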